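(* Let $\mathcal{G}$ be a finite Abelian group, $g_0,g_1,\dots,g_n\in\mathcal{G}$, and let $P=\operatorname{conv}\{x\in\mathbb{Z}^n_{\ge0}: \sum_{i=1}^n x_ig_i=g_0\}$. Let $F$ be a $d$-dimensional face of $P$ and $p\in F\cap\mathbb{Z}^n$. Then there exists a set of indices $J\subseteq\{1,\dots,n\}$ with $|J|\ge n-d$ and $\prod_{i\in J}(1+p_i)\le|\mathcal{G}|$.
   Formalization: The integer point p of F is additionally required to be nonnegative and satisfy the group equation ∑ p_i g_i = g_0; for arbitrary integer points of F the claim is false (there is a counterexample with n = 6, d = 1). *)

theory Defs
  imports "HOL-Analysis.Analysis" "HOL-Algebra.Coset" "HOL-Algebra.FiniteProduct"
begin

(* Groups are written multiplicatively in HOL-Algebra, so the equation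
   x_1 g_1 + ... + x_n g_n = g0 becomes the product of the powers g_i [^] x_i.
   The coordinates run over the finite type 'n, so that n = CARD('n). *)

definition group_relaxation_points ::
    "('a, 'b) monoid_scheme \<Rightarrow> 'a \<Rightarrow> ('n::finite \<Rightarrow> 'a) \<Rightarrow> (real ^ 'n) set"
  where "group_relaxation_points G g0 g =
    {x. \<exists>k :: 'n \<Rightarrow> nat. (\<forall>i. x $ i = real (k i)) \<and>
          (\<Otimes>\<^bsub>G\<^esub>i\<in>UNIV. g i [^]\<^bsub>G\<^esub> k i) = g0}"

definition corner_polyhedron ::
    "('a, 'b) monoid_scheme \<Rightarrow> 'a \<Rightarrow> ('n::finite \<Rightarrow> 'a) \<Rightarrow> (real ^ 'n) set"
  where "corner_polyhedron G g0 g = convex hull (group_relaxation_points G g0 g)"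

(* Pitfall: the corner polyhedron may contain vectors with integer coordinates that do not
   satisfy the group equation (G = Z/2, n = 1, g_1 = 1, g0 = 0: the points are the even
   numbers, their hull is [0, oo)).  "Integer point of a face" therefore has to be read as
   membership in group_relaxation_points. *)

end

theory Submission
  imports Defs
begin

text \<open>
  Let \<open>L\<close> be the linear space parallel to \<open>F\<close>, and let \<open>J\<close> be a set of at least \<open>n - d\<close>
  coordinates whose coordinate subspace meets \<open>L\<close> trivially. If two integer vectors \<open>y\<close>, \<open>y'\<close>
  with \<open>0 \<le> y, y' \<le> p\<close> supported on \<open>J\<close> have the same image in the group, then both
  \<open>p + (y - y')\<close> and \<open>p - (y - y')\<close> lie in the corner polyhedron; as \<open>p\<close> is their midpoint
  they lie in \<open>F\<close>, so \<open>y - y'\<close> lies in \<open>L\<close> and vanishes. Hence the \<open>\<Prod>i\<in>J. 1 + p\<^sub>i\<close>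
  such vectors have distinct images in the group.
\<close>

text \<open>Steinitz exchange: a basis \<open>B\<close> of \<open>span L\<close> is completed to a
  basis \<open>C\<close> of the whole space using standard basis vectors only. The indices of the
  added vectors form \<open>J\<close>, so the coordinate subspace of \<open>J\<close> is
  complementary to \<open>span L\<close>.\<close>

lemma coordinate_complement:
  fixes L :: "(real ^ 'n) set"
  obtains J :: "'n set" where "CARD('n) \<le> card J + dim L"
    and "\<And>v. v \<in> L \<Longrightarrow> (\<And>i. i \<notin> J \<Longrightarrow> v $ i = 0) \<Longrightarrow> v = 0"
proof -
  obtain B where B: "B \<subseteq> L" "independent B" "L \<subseteq> span B" "card B = dim L"
    using basis_exists by metis
  obtain C where C: "B \<subseteq> C" "C \<subseteq> B \<union> Basis" "independent C" "B \<union> Basis \<subseteq> span C"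
    using maximal_independent_subset_extend[OF _ B(2), of "B \<union> Basis"] by blast
  define J where "J = {i::'n. axis i 1 \<in> C - B}"
  have CB: "C - B = (\<lambda>i. axis i 1) ` J"
    using C(2) by (auto simp: J_def Basis_vec_def)
  have finC: "finite C" and finB: "finite B"
    using C(3) B(2) by (auto intro: independent_imp_finite)
  have "span C = UNIV"
    using span_minimal[of Basis "span C"] C(4) by auto
  then have cardC: "card C = CARD('n)"
    using dim_span[of C] dim_eq_card_independent[OF C(3)] by simp
  have "card (C - B) \<le> card J"
    unfolding CB by (rule card_image_le) simp
  moreover have "card (C - B) = CARD('n) - dim L"
    using card_Diff_subset[OF finB C(1)] cardC B(4) by simp
  ultimately have 1: "CARD('n) \<le> card J + dim L"
    by linarith
  \<comment> \<open>The two spans together generate the whole space and their dimensions add up to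
    \<open>CARD('n)\<close>, so the dimension formula leaves dimension 0 for the
    intersection.\<close>
  have disj: "span B \<inter> span (C - B) = {0}"
  proof -
    have "B \<union> (C - B) = C"
      using C(1) by blast
    then have "{x + y |x y. x \<in> span B \<and> y \<in> span (C - B)} = UNIV"
      using \<open>span C = UNIV\<close> span_Un[of B "C - B"] by auto
    then have "dim {x + y |x y. x \<in> span B \<and> y \<in> span (C - B)} = CARD('n)"
      by simp
    moreover have "dim (span B) + dim (span (C - B)) = CARD('n)"
      using B(2) C(3) cardC card_Diff_subset[OF finB C(1)] card_mono[OF finC C(1)]
      by (simp add: dim_eq_card_independent independent_mono[of C "C - B"])
    ultimately have "dim (span B \<inter> span (C - B)) = 0"
      using dim_sums_Int[of "span B" "span (C - B)"] by simp
    then show ?thesis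
      by (auto simp: span_zero)
  qed
  have 2: "v = 0" if "v \<in> L" "\<And>i. i \<notin> J \<Longrightarrow> v $ i = 0" for v
  proof -
    have "v = (\<Sum>i\<in>UNIV. v $ i *\<^sub>R axis i 1)"
      by (simp add: vec_eq_iff axis_def if_distrib cong: if_cong)
    also have "\<dots> = (\<Sum>i\<in>J. v $ i *\<^sub>R axis i 1)"
      by (rule sum.mono_neutral_right) (auto simp: that(2))
    also have "\<dots> \<in> span (C - B)"
      unfolding CB by (intro span_sum span_scale span_base) auto
    finally show ?thesis
      using disj that(1) B(3) by auto
  qed
  show thesis using that 1 2 by blast
qed

lemma face_of_symmetric_segment:
  assumes "F face_of S" "p \<in> F" "p + v \<in> S" "p - v \<in> S"
  shows "p + v \<in> F"
proof (cases "v = 0")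
  case False
  then have "p + v \<noteq> p - v"
    by (simp add: algebra_simps eq_neg_iff_add_eq_0 flip: scaleR_2)
  moreover have "midpoint (p + v) (p - v) = p"
    by (simp add: midpoint_def flip: scaleR_2)
  ultimately have "p \<in> open_segment (p + v) (p - v)"
    by (metis midpoint_in_open_segment)
  then show ?thesis
    using assms by (meson face_ofD)
qed (use assms in simp)

lemma (in comm_group) finprod_pow_add:
  assumes "\<And>i. i \<in> I \<Longrightarrow> g i \<in> carrier G"
  shows "(\<Otimes>i\<in>I. g i [^] (k i + l i :: nat)) = (\<Otimes>i\<in>I. g i [^] k i) \<otimes> (\<Otimes>i\<in>I. g i [^] l i)"
proof -
  have "(\<Otimes>i\<in>I. g i [^] (k i + l i)) = (\<Otimes>i\<in>I. g i [^] k i \<otimes> g i [^] l i)"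
    using assms by (intro finprod_cong') (auto simp: nat_pow_mult)
  also have "\<dots> = (\<Otimes>i\<in>I. g i [^] k i) \<otimes> (\<Otimes>i\<in>I. g i [^] l i)"
    using assms by (intro finprod_multf) auto
  finally show ?thesis .
qed

text \<open>Trading \<open>z\<close> for \<open>y\<close> inside \<open>k\<close> preserves the
  group equation, and \<open>z \<le> k\<close> keeps the exponents nonnegative. The result is thus a
  generating point of the hull.\<close>

lemma exchange_in_corner_polyhedron:
  fixes g :: "'n::finite \<Rightarrow> 'a"
  assumes "comm_group G" "\<And>i. g i \<in> carrier G"
    and k: "(\<Otimes>\<^bsub>G\<^esub>i\<in>UNIV. g i [^]\<^bsub>G\<^esub> k i) = g0"
    and le: "\<And>i. z i \<le> k i"
    and eq: "(\<Otimes>\<^bsub>G\<^esub>i\<in>UNIV. g i [^]\<^bsub>G\<^esub> y i) = (\<Otimes>\<^bsub>G\<^esub>i\<in>UNIV. g i [^]\<^bsub>G\<^esub> z i)"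
  shows "(\<chi> i. real (k i) + (real (y i) - real (z i))) \<in> corner_polyhedron G g0 g"
proof -
  interpret comm_group G by fact
  let ?h = "\<lambda>k. \<Otimes>\<^bsub>G\<^esub>i\<in>UNIV. g i [^]\<^bsub>G\<^esub> (k i :: nat)"
  \<comment> \<open>Both sides share the factor with exponents \<open>k i - z i\<close>. This
    subtraction on naturals is not truncated, thanks to \<open>le\<close>.\<close>
  have "?h (\<lambda>i. (k i - z i) + y i) = ?h (\<lambda>i. (k i - z i) + z i)"
    using assms(2) eq by (simp add: finprod_pow_add)
  also have "\<dots> = g0"
    using k le by simp
  finally have "?h (\<lambda>i. (k i - z i) + y i) = g0" .
  moreover have "real (k i) + (real (y i) - real (z i)) = real ((k i - z i) + y i)" for i
    using le[of i] by linarith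
  ultimately show ?thesis
    unfolding corner_polyhedron_def group_relaxation_points_def
    by (intro hull_inc CollectI exI[of _ "\<lambda>i. (k i - z i) + y i"]) simp
qed

theorem theorem10:
  fixes G :: "('a, 'b) monoid_scheme"
    and g0 :: 'a
    and g :: "'n::finite \<Rightarrow> 'a"
    and F :: "(real ^ 'n) set"
    and d :: nat
    and p :: "real ^ 'n"
  assumes "comm_group G"
    and "finite (carrier G)"
    and "g0 \<in> carrier G"
    and "\<And>i. g i \<in> carrier G"
    and "F face_of corner_polyhedron G g0 g"
    and "aff_dim F = int d"
    and "p \<in> F \<inter> group_relaxation_points G g0 g"
  shows "\<exists>J :: 'n set. int (card J) \<ge> int CARD('n) - int d \<and>
           (\<Prod>i\<in>J. 1 + p $ i) \<le> real (order G)"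
proof -
  interpret comm_group G by fact
  let ?h = "\<lambda>k. \<Otimes>\<^bsub>G\<^esub>i\<in>UNIV. g i [^]\<^bsub>G\<^esub> (k i :: nat)"
  have pF: "p \<in> F"
    using assms(7) by simp
  obtain k where k: "\<And>i. p $ i = real (k i)" "?h k = g0"
    using assms(7) unfolding group_relaxation_points_def by auto
  \<comment> \<open>Since \<open>p\<close> lies in \<open>F\<close>, this is the direction space of
    the affine hull of \<open>F\<close>.\<close>
  define L where "L = span ((+) (- p) ` F)"
  have dimL: "dim L = d"
    using aff_dim_eq_dim[of p F] assms(6) pF by (simp add: L_def hull_inc)
  obtain J :: "'n set" where J: "CARD('n) \<le> card J + dim L"
    "\<And>v. v \<in> L \<Longrightarrow> (\<And>i. i \<notin> J \<Longrightarrow> v $ i = 0) \<Longrightarrow> v = 0"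
    using coordinate_complement[of L] by blast
  \<comment> \<open>Members of \<open>Y\<close> are \<open>undefined\<close> off \<open>J\<close>,
    which makes the count a product; \<open>e\<close> puts 0 there to obtain exponent vectors
    supported on \<open>J\<close>.\<close>
  define Y where "Y = (\<Pi>\<^sub>E i\<in>J. {..k i})"
  define e where "e y i = (if i \<in> J then y i else 0)" for y :: "'n \<Rightarrow> nat" and i
  have e_le: "e y i \<le> k i" if "y \<in> Y" for y i
    using that by (auto simp: Y_def e_def)
  have "inj_on (\<lambda>y. ?h (e y)) Y"
  proof (rule inj_onI)
    fix y z assume yz: "y \<in> Y" "z \<in> Y" and eq: "?h (e y) = ?h (e z)"
    define v :: "real ^ 'n" where "v = (\<chi> i. real (e y i) - real (e z i))"
    have "p + v = (\<chi> i. real (k i) + (real (e y i) - real (e z i)))"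
      "p - v = (\<chi> i. real (k i) + (real (e z i) - real (e y i)))"
      by (simp_all add: vec_eq_iff v_def k(1))
    \<comment> \<open>The exchange is applied in both directions, as \<open>e y\<close> and
      \<open>e z\<close> are both bounded by \<open>k\<close>.\<close>
    then have "p + v \<in> corner_polyhedron G g0 g" "p - v \<in> corner_polyhedron G g0 g"
      using exchange_in_corner_polyhedron[OF assms(1) assms(4) k(2) e_le] yz eq by simp_all
    then have "p + v \<in> F"
      using face_of_symmetric_segment[OF assms(5) pF] by blast
    then have "v \<in> L"
      unfolding L_def by (intro span_base) (auto intro!: image_eqI[of _ _ "p + v"])
    then have "v = 0"
      by (rule J(2)) (simp add: v_def e_def)
    then have "e y i = e z i" for i
      by (simp add: v_def vec_eq_iff)
    then have "y i = z i" if "i \<in> J" for i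
      using that unfolding e_def by metis
    then show "y = z"
      using yz unfolding Y_def by (blast intro: PiE_ext)
  qed
  moreover have "(\<lambda>y. ?h (e y)) ` Y \<subseteq> carrier G"
    using assms(4) by (auto intro!: finprod_closed)
  ultimately have "card Y \<le> order G"
    unfolding order_def using assms(2) by (intro card_inj_on_le)
  moreover have "real (card Y) = (\<Prod>i\<in>J. 1 + p $ i)"
    by (simp add: Y_def card_PiE k(1))
  ultimately show ?thesis
    using J(1) dimL by (intro exI[of _ J]) linarith
qed

end
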